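(* Let $\mathbf P=(P,\le,0,1,+,\cdot)$ be a cancellative ordered semiring. Then $(\bar{\mathcal O}_{\mathbf P},[\delta],[\rho])$ on $\mathsf{Pos}$ lifts $(\mathcal O_{\mathbf P},\delta,\rho)$ on $\mathsf{Sets}$. That is, for every poset $(X,\le)$ the heavier-higher preorder $\sqsubseteq$ on $\mathcal O_{\mathbf P}X$ is antisymmetric, so that (identifying $[\theta]$ with $\theta$) the underlying set of $\bar{\mathcal O}_{\mathbf P}(X,\le)$ is $\mathcal O_{\mathbf P}X$, the underlying function of $\bar{\mathcal O}_{\mathbf P}(h)$ is $\mathcal O_{\mathbf P}(h)$ for every monotone map $h$, and the underlying functions of the components of $[\delta]$ and $[\rho]$ at $(X,\le)$ are the components of $\delta$ and $\rho$ at $X$.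
   Context: A semiring $(P,0,1,+,\cdot)$ is a set with $(P,0,+)$ a commutative monoid, $(P,1,\cdot)$ a monoid, $0r=r0=0$, $r(s+t)=rs+rt$ and $(s+t)r=sr+tr$. An ordered semiring $\mathbf P=(P,\le,0,1,+,\cdot)$ is a semiring with a partial order $\le$ on $P$ having $0$ as bottom element and such that $+$ and $\cdot$ are monotone. It is *cancellative* if for all $r,s,t$, $r+s\le r+t$ implies $s\le t$. $\mathsf{Sets}$ is the category of sets, and $\mathsf{Pos}$ the category of posets and monotone maps. For a set $X$, $\mathcal O_{\mathbf P}X$ is the set of functions $\theta:X\to P$ with finite support $\{x:\theta(x)\ne0\}$; for a function $h:X\to Y$, $\mathcal O_{\mathbf P}(h)(\theta)(y)=h^\bullet\theta(y)=\sum_{h(x)=y}\theta(x)$. The transformation $\delta$ has components $x\mapsto\delta_x$, where $\delta_x$ is $1$ at $x$ and $0$ elsewhere. The transformation $\rho$ has components $\rho_X:1+P\times\mathcal O_{\mathbf P}X+(\mathcal O_{\mathbf P}X)^2\to\mathcal O_{\mathbf P}X$ given by the constant $0$, $(r,\theta)\mapsto r\theta$, and $(\theta_1,\theta_2)\mapsto\theta_1+\theta_2$, all evaluated pointwise. For a poset $(X,\le)$, the heavier-higher preorder on $\mathcal O_{\mathbf P}X$ is: $\theta_1\sqsubseteq\theta_2$ iff $\sum_{x\in U}\theta_1(x)\le\sum_{x\in U}\theta_2(x)$ for every upwards-closed $U\subseteq X$ (i.e. $x\in U$, $x\le y$ imply $y\in U$). Write $\theta_1\equiv\theta_2$ iff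 $\theta_1\sqsubseteq\theta_2\sqsubseteq\theta_1$, let $[\theta]$ be the $\equiv$-class of $\theta$, and $\bar{\mathcal O}_{\mathbf P}(X,\le)=(\mathcal O_{\mathbf P}X/{\equiv},\sqsubseteq)$, acting on monotone $h$ by $[\theta]\mapsto[h^\bullet\theta]$. The transformation $[\delta]$ has components $x\mapsto[\delta_x]$, and $[\rho]$ sends the constant to $[0]$, $(r,[\theta])$ to $[r\theta]$, and $([\theta_1],[\theta_2])$ to $[\theta_1+\theta_2]$. *)

theory Defs
  imports Main "HOL-Library.FuncSet"
begin

text \<open>Since \<open>0\<close> is the bottom element, the nonnegativity side conditions on the monotonicity
  of multiplication in \<^class>\<open>ordered_semiring\<close> are vacuous. Multiplication need not be
  commutative, \<open>0 = 1\<close> is allowed, and the order need not be linear.\<close>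

class bot_ordered_semiring = ordered_semiring_0 + monoid_mult +
  assumes zero_bot: "0 \<le> a"

definition cancellative :: "'p::bot_ordered_semiring itself \<Rightarrow> bool" where
  "cancellative _ \<longleftrightarrow> (\<forall>r s t :: 'p. r + s \<le> r + t \<longrightarrow> s \<le> t)"


text \<open>Sets and posets are given by carrier sets, so that the empty poset is included; the order
  relation is only relevant on the carrier.\<close>

definition poset_on :: "'a set \<Rightarrow> ('a \<Rightarrow> 'a \<Rightarrow> bool) \<Rightarrow> bool" where
  "poset_on X le \<longleftrightarrow> reflp_on X le \<and> antisymp_on X le \<and> transp_on X le"

definition pos_hom ::
  "'a set \<Rightarrow> ('a \<Rightarrow> 'a \<Rightarrow> bool) \<Rightarrow> 'b set \<Rightarrow> ('b \<Rightarrow> 'b \<Rightarrow> bool) \<Rightarrow> ('a \<Rightarrow> 'b) \<Rightarrow> bool" where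
  "pos_hom X le Y le' h \<longleftrightarrow> h \<in> X \<rightarrow> Y \<and> monotone_on X le le' h"


text \<open>A function \<open>X \<rightarrow> P\<close> is represented by its extension by \<open>0\<close> outside \<open>X\<close>.\<close>

definition OP :: "'a set \<Rightarrow> ('a \<Rightarrow> 'p::bot_ordered_semiring) set" where
  "OP X = {\<theta>. finite {x. \<theta> x \<noteq> 0} \<and> {x. \<theta> x \<noteq> 0} \<subseteq> X}"

text \<open>The sum of \<open>\<theta>\<close> over a possibly infinite set \<open>U\<close>. It is restricted to the support because
  \<^const>\<open>sum\<close> over an infinite set is \<open>0\<close> by convention.\<close>

definition mass :: "('a \<Rightarrow> 'p::bot_ordered_semiring) \<Rightarrow> 'a set \<Rightarrow> 'p" where
  "mass \<theta> U = (\<Sum>x\<in>{x \<in> U. \<theta> x \<noteq> 0}. \<theta> x)"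

definition OP_map :: "('a \<Rightarrow> 'b) \<Rightarrow> ('a \<Rightarrow> 'p::bot_ordered_semiring) \<Rightarrow> 'b \<Rightarrow> 'p" where
  "OP_map h \<theta> y = mass \<theta> {x. h x = y}"

definition delta :: "'a \<Rightarrow> 'a \<Rightarrow> 'p::bot_ordered_semiring" where
  "delta x = (\<lambda>y. if y = x then 1 else 0)"

text \<open>The functor \<open>A \<mapsto> 1 + P \<times> A + A\<^sup>2\<close>: on carriers, on maps, and on orders (coproduct and
  product orders, with the given order on \<open>P\<close>).\<close>

type_synonym ('p, 'c) sig = "unit + ('p \<times> 'c + 'c \<times> 'c)"

definition sig_set :: "'c set \<Rightarrow> ('p, 'c) sig set" where
  "sig_set A = UNIV <+> ((UNIV \<times> A) <+> (A \<times> A))"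

definition sig_map :: "('c \<Rightarrow> 'd) \<Rightarrow> ('p, 'c) sig \<Rightarrow> ('p, 'd) sig" where
  "sig_map f = map_sum id (map_sum (map_prod id f) (map_prod f f))"

definition sig_le :: "('c \<Rightarrow> 'c \<Rightarrow> bool) \<Rightarrow> ('p::ord, 'c) sig \<Rightarrow> ('p, 'c) sig \<Rightarrow> bool" where
  "sig_le le = rel_sum (=) (rel_sum (rel_prod (\<le>) le) (rel_prod le le))"

definition zeroF :: "'a \<Rightarrow> 'p::bot_ordered_semiring" where
  "zeroF = (\<lambda>x. 0)"

definition scaleF :: "'p::bot_ordered_semiring \<Rightarrow> ('a \<Rightarrow> 'p) \<Rightarrow> 'a \<Rightarrow> 'p" where
  "scaleF r \<theta> = (\<lambda>x. r * \<theta> x)"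

definition addF :: "('a \<Rightarrow> 'p::bot_ordered_semiring) \<Rightarrow> ('a \<Rightarrow> 'p) \<Rightarrow> 'a \<Rightarrow> 'p" where
  "addF \<theta>1 \<theta>2 = (\<lambda>x. \<theta>1 x + \<theta>2 x)"

fun rho :: "('p::bot_ordered_semiring, 'a \<Rightarrow> 'p) sig \<Rightarrow> 'a \<Rightarrow> 'p" where
  "rho (Inl u) = zeroF"
| "rho (Inr (Inl (r, \<theta>))) = scaleF r \<theta>"
| "rho (Inr (Inr (\<theta>1, \<theta>2))) = addF \<theta>1 \<theta>2"


definition upclosed :: "'a set \<Rightarrow> ('a \<Rightarrow> 'a \<Rightarrow> bool) \<Rightarrow> 'a set \<Rightarrow> bool" where
  "upclosed X le U \<longleftrightarrow> U \<subseteq> X \<and> (\<forall>x\<in>U. \<forall>y\<in>X. le x y \<longrightarrow> y \<in> U)"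

definition heavier_higher ::
  "'a set \<Rightarrow> ('a \<Rightarrow> 'a \<Rightarrow> bool) \<Rightarrow> ('a \<Rightarrow> 'p::bot_ordered_semiring) \<Rightarrow> ('a \<Rightarrow> 'p) \<Rightarrow> bool" where
  "heavier_higher X le \<theta>1 \<theta>2 \<longleftrightarrow> (\<forall>U. upclosed X le U \<longrightarrow> mass \<theta>1 U \<le> mass \<theta>2 U)"

definition hh_equiv ::
  "'a set \<Rightarrow> ('a \<Rightarrow> 'a \<Rightarrow> bool) \<Rightarrow> (('a \<Rightarrow> 'p::bot_ordered_semiring) \<times> ('a \<Rightarrow> 'p)) set" where
  "hh_equiv X le = {(\<theta>1, \<theta>2). \<theta>1 \<in> OP X \<and> \<theta>2 \<in> OP X \<and>
     heavier_higher X le \<theta>1 \<theta>2 \<and> heavier_higher X le \<theta>2 \<theta>1}"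

definition hh_class ::
  "'a set \<Rightarrow> ('a \<Rightarrow> 'a \<Rightarrow> bool) \<Rightarrow> ('a \<Rightarrow> 'p::bot_ordered_semiring) \<Rightarrow> ('a \<Rightarrow> 'p) set" where
  "hh_class X le \<theta> = hh_equiv X le `` {\<theta>}"


definition OPbar :: "'a set \<Rightarrow> ('a \<Rightarrow> 'a \<Rightarrow> bool) \<Rightarrow> ('a \<Rightarrow> 'p::bot_ordered_semiring) set set" where
  "OPbar X le = OP X // hh_equiv X le"

definition OPbar_le ::
  "'a set \<Rightarrow> ('a \<Rightarrow> 'a \<Rightarrow> bool) \<Rightarrow> ('a \<Rightarrow> 'p::bot_ordered_semiring) set \<Rightarrow> ('a \<Rightarrow> 'p) set \<Rightarrow> bool"
  where
  "OPbar_le X le c1 c2 \<longleftrightarrow> (\<exists>\<theta>1\<in>c1. \<exists>\<theta>2\<in>c2. heavier_higher X le \<theta>1 \<theta>2)"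

text \<open>Operations on classes are defined as the union of the classes of the results over all
  representatives, the usual rendering of a function on a quotient: the union is a single class
  exactly when that class does not depend on the representatives.\<close>

definition OPbar_map ::
  "'b set \<Rightarrow> ('b \<Rightarrow> 'b \<Rightarrow> bool) \<Rightarrow> ('a \<Rightarrow> 'b) \<Rightarrow> ('a \<Rightarrow> 'p::bot_ordered_semiring) set \<Rightarrow> ('b \<Rightarrow> 'p) set"
  where
  "OPbar_map Y le' h c = (\<Union>\<theta>\<in>c. hh_class Y le' (OP_map h \<theta>))"

definition delta_bar ::
  "'a set \<Rightarrow> ('a \<Rightarrow> 'a \<Rightarrow> bool) \<Rightarrow> 'a \<Rightarrow> ('a \<Rightarrow> 'p::bot_ordered_semiring) set" where
  "delta_bar X le x = hh_class X le (delta x)"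

fun rho_bar ::
  "'a set \<Rightarrow> ('a \<Rightarrow> 'a \<Rightarrow> bool) \<Rightarrow> ('p::bot_ordered_semiring, ('a \<Rightarrow> 'p) set) sig \<Rightarrow> ('a \<Rightarrow> 'p) set"
  where
  "rho_bar X le (Inl u) = hh_class X le zeroF"
| "rho_bar X le (Inr (Inl (r, c))) = (\<Union>\<theta>\<in>c. hh_class X le (scaleF r \<theta>))"
| "rho_bar X le (Inr (Inr (c1, c2))) =
     (\<Union>\<theta>1\<in>c1. \<Union>\<theta>2\<in>c2. hh_class X le (addF \<theta>1 \<theta>2))"

end

theory Submission
  imports Defs
begin

text \<open>For \<open>x \<in> X\<close> both the principal upset \<open>\<up>x\<close> and \<open>\<up>x - {x}\<close> are upwards closed, and their
  masses under \<open>\<theta>\<close> differ by the summand \<open>\<theta> x\<close>. Equivalent \<open>\<theta>1\<close>, \<open>\<theta>2\<close> give equal mass to both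
  upsets, so cancellation yields \<open>\<theta>1 x = \<theta>2 x\<close>. Hence every class is a singleton, and the operations
  on classes are those on representatives. They are monotone because the mass of an upset is
  additive and homogeneous in \<open>\<theta>\<close>, and turns \<open>OP_map h\<close> into taking the preimage of the upset.\<close>

section \<open>Masses of finitely supported functions\<close>

lemma OP_finite_support: "\<theta> \<in> OP X \<Longrightarrow> finite {x. \<theta> x \<noteq> 0}"
  by (simp add: OP_def)

lemma OP_outside: "\<theta> \<in> OP X \<Longrightarrow> x \<notin> X \<Longrightarrow> \<theta> x = 0"
  by (auto simp: OP_def)

text \<open>Allows any finite superset of the support as index set, so that masses of several
  functions, or over several sets, can be compared over a common \<open>A\<close>.\<close>

lemma mass_eq_sum:
  assumes "finite A" "{x. \<theta> x \<noteq> 0} \<subseteq> A"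
  shows "mass \<theta> U = sum \<theta> (A \<inter> U)"
  unfolding mass_def using assms by (intro sum.mono_neutral_left) auto

lemma mass_insert:
  assumes "finite {x. \<theta> x \<noteq> 0}" "x \<notin> U"
  shows "mass \<theta> (insert x U) = mass \<theta> U + \<theta> x"
proof -
  \<comment> \<open>Adjoining \<open>x\<close> to the support lets the summand
    \<open>\<theta> x\<close> split off even when it is 0.\<close>
  let ?A = "insert x {x. \<theta> x \<noteq> 0}"
  have "mass \<theta> V = sum \<theta> (?A \<inter> V)" for V
    using assms by (intro mass_eq_sum) auto
  moreover have "?A \<inter> insert x U = insert x (?A \<inter> U)" by auto
  ultimately show ?thesis
    using assms by (simp add: add.commute)
qed

lemma mass_delta: "mass (delta x) U = (if x \<in> U then 1 else 0)"
proof -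
  have "mass (delta x) U = sum (delta x) ({x} \<inter> U)"
    by (intro mass_eq_sum) (auto simp: delta_def)
  then show ?thesis by (auto simp: delta_def)
qed

lemma mass_scaleF:
  assumes "finite {x. \<theta> x \<noteq> 0}"
  shows "mass (scaleF r \<theta>) U = r * mass \<theta> U"
proof -
  let ?A = "{x. \<theta> x \<noteq> 0}"
  have "mass (scaleF r \<theta>) U = sum (scaleF r \<theta>) (?A \<inter> U)"
    using assms by (intro mass_eq_sum) (auto simp: scaleF_def)
  also have "\<dots> = r * sum \<theta> (?A \<inter> U)"
    by (simp add: scaleF_def sum_distrib_left)
  also have "sum \<theta> (?A \<inter> U) = mass \<theta> U"
    using assms by (intro mass_eq_sum[symmetric]) auto
  finally show ?thesis .
qed

lemma mass_addF:
  assumes "finite {x. \<theta>1 x \<noteq> 0}" "finite {x. \<theta>2 x \<noteq> 0}"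
  shows "mass (addF \<theta>1 \<theta>2) U = mass \<theta>1 U + mass \<theta>2 U"
proof -
  let ?A = "{x. \<theta>1 x \<noteq> 0} \<union> {x. \<theta>2 x \<noteq> 0}"
  have "mass \<theta> U = sum \<theta> (?A \<inter> U)" if "\<theta> \<in> {\<theta>1, \<theta>2, addF \<theta>1 \<theta>2}" for \<theta>
    using assms that by (intro mass_eq_sum) (auto simp: addF_def)
  then show ?thesis by (simp add: addF_def sum.distrib)
qed

text \<open>The sum over a fibre that misses the support of \<open>\<theta>\<close> is
  empty.\<close>

lemma OP_map_support: "{y. OP_map h \<theta> y \<noteq> 0} \<subseteq> h ` {x. \<theta> x \<noteq> 0}"
proof
  fix y assume y: "y \<in> {y. OP_map h \<theta> y \<noteq> 0}"
  have "OP_map h \<theta> y = 0" if "{x \<in> {x. h x = y}. \<theta> x \<noteq> 0} = {}"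
    unfolding OP_map_def mass_def that by simp
  with y show "y \<in> h ` {x. \<theta> x \<noteq> 0}" by auto
qed

lemma mass_OP_map:
  assumes "finite {x. \<theta> x \<noteq> 0}"
  shows "mass (OP_map h \<theta>) U = mass \<theta> (h -` U)"
proof -
  let ?A = "{x. \<theta> x \<noteq> 0}"
  have "mass (OP_map h \<theta>) U = sum (OP_map h \<theta>) (h ` ?A \<inter> U)"
    using assms by (intro mass_eq_sum finite_imageI OP_map_support)
  also have "\<dots> = (\<Sum>y\<in>h ` ?A \<inter> U. sum \<theta> {x \<in> ?A \<inter> h -` U. h x = y})"
    by (intro sum.cong refl) (auto simp: OP_map_def mass_def intro!: sum.cong)
  \<comment> \<open>The fibres of \<open>h\<close> over the image of the support within
    \<open>U\<close> partition the support points that \<open>h\<close> sends into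
    \<open>U\<close>.\<close>
  also have "\<dots> = sum \<theta> (?A \<inter> h -` U)"
    using assms by (intro sum.group) auto
  also have "\<dots> = mass \<theta> (h -` U)"
    using assms by (intro mass_eq_sum[symmetric]) auto
  finally show ?thesis .
qed

text \<open>Needed because \<open>h\<close> is a total function: the preimage of an upset may
  contain points outside \<open>X\<close>, but \<open>\<theta>\<close> vanishes there.\<close>

lemma mass_Int_carrier: "\<theta> \<in> OP X \<Longrightarrow> mass \<theta> (X \<inter> U) = mass \<theta> U"
  unfolding mass_def by (intro sum.cong) (auto simp: OP_def)

section \<open>Closure of \<open>OP\<close> under the operations\<close>

lemma zeroF_OP: "zeroF \<in> OP X"
  by (simp add: OP_def zeroF_def)

lemma delta_OP: "x \<in> X \<Longrightarrow> delta x \<in> OP X"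
  by (auto simp: OP_def delta_def)

lemma scaleF_OP:
  assumes "\<theta> \<in> OP X"
  shows "scaleF r \<theta> \<in> OP X"
proof -
  have "{x. scaleF r \<theta> x \<noteq> 0} \<subseteq> {x. \<theta> x \<noteq> 0}"
    by (auto simp: scaleF_def)
  then show ?thesis
    using assms unfolding OP_def by (blast intro: finite_subset)
qed

lemma addF_OP:
  assumes "\<theta>1 \<in> OP X" "\<theta>2 \<in> OP X"
  shows "addF \<theta>1 \<theta>2 \<in> OP X"
proof -
  have "{x. addF \<theta>1 \<theta>2 x \<noteq> 0} \<subseteq> {x. \<theta>1 x \<noteq> 0} \<union> {x. \<theta>2 x \<noteq> 0}"
    by (auto simp: addF_def)
  moreover have "finite ({x. \<theta>1 x \<noteq> 0} \<union> {x. \<theta>2 x \<noteq> 0})"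
      "{x. \<theta>1 x \<noteq> 0} \<union> {x. \<theta>2 x \<noteq> 0} \<subseteq> X"
    using assms by (auto simp: OP_def)
  ultimately show ?thesis
    unfolding OP_def by (blast intro: finite_subset)
qed

lemma OP_map_OP:
  assumes "\<theta> \<in> OP X" "h \<in> X \<rightarrow> Y"
  shows "OP_map h \<theta> \<in> OP Y"
proof -
  have "finite (h ` {x. \<theta> x \<noteq> 0})" "h ` {x. \<theta> x \<noteq> 0} \<subseteq> Y"
    using assms by (auto simp: OP_def)
  then show ?thesis
    using OP_map_support[of h \<theta>] unfolding OP_def by (blast intro: finite_subset)
qed

lemma rho_OP: "t \<in> sig_set (OP X) \<Longrightarrow> rho t \<in> OP X"
  by (auto simp: sig_set_def zeroF_OP scaleF_OP addF_OP)

section \<open>Monotonicity of the operations for the heavier-higher preorder\<close>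

lemma heavier_higher_refl: "heavier_higher X le \<theta> \<theta>"
  by (simp add: heavier_higher_def)

lemma heavier_higher_trans:
  "heavier_higher X le \<theta>1 \<theta>2 \<Longrightarrow> heavier_higher X le \<theta>2 \<theta>3 \<Longrightarrow> heavier_higher X le \<theta>1 \<theta>3"
  unfolding heavier_higher_def by (meson order_trans)

text \<open>An upset containing \<open>x\<close> contains \<open>y\<close>, so both masses are 1;
  for any other upset the left mass is 0, the bottom element.\<close>

lemma heavier_higher_delta:
  "x \<in> X \<Longrightarrow> y \<in> X \<Longrightarrow> le x y \<Longrightarrow> heavier_higher X le (delta x) (delta y)"
  by (auto simp: heavier_higher_def upclosed_def mass_delta zero_bot)

lemma heavier_higher_scaleF:
  assumes "r \<le> s" "heavier_higher X le \<theta>1 \<theta>2" "\<theta>1 \<in> OP X" "\<theta>2 \<in> OP X"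
  shows "heavier_higher X le (scaleF r \<theta>1) (scaleF s \<theta>2)"
  using assms unfolding heavier_higher_def
  by (simp add: mass_scaleF OP_finite_support mult_mono zero_bot)

lemma heavier_higher_addF:
  assumes "heavier_higher X le \<theta>1 \<eta>1" "heavier_higher X le \<theta>2 \<eta>2"
    and "\<theta>1 \<in> OP X" "\<theta>2 \<in> OP X" "\<eta>1 \<in> OP X" "\<eta>2 \<in> OP X"
  shows "heavier_higher X le (addF \<theta>1 \<theta>2) (addF \<eta>1 \<eta>2)"
  using assms unfolding heavier_higher_def
  by (simp add: mass_addF OP_finite_support add_mono)

text \<open>Terms related by \<open>sig_le\<close> lie in the same summand of the coproduct, which
  leaves one monotonicity fact per operation; the constant needs only reflexivity.\<close>

lemma heavier_higher_rho:
  assumes "sig_le (heavier_higher X le) s t" "s \<in> sig_set (OP X)" "t \<in> sig_set (OP X)"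
  shows "heavier_higher X le (rho s) (rho t)"
  using assms unfolding sig_le_def sig_set_def
  by (auto elim!: rel_sum.cases
      intro: heavier_higher_refl heavier_higher_scaleF heavier_higher_addF)

lemma upclosed_vimage:
  assumes "pos_hom X le Y le' h" "upclosed Y le' U"
  shows "upclosed X le (X \<inter> h -` U)"
  using assms unfolding upclosed_def pos_hom_def monotone_on_def by blast

lemma heavier_higher_OP_map:
  assumes "pos_hom X le Y le' h" "heavier_higher X le \<theta>1 \<theta>2" "\<theta>1 \<in> OP X" "\<theta>2 \<in> OP X"
  shows "heavier_higher Y le' (OP_map h \<theta>1) (OP_map h \<theta>2)"
  unfolding heavier_higher_def
proof (intro allI impI)
  fix U assume "upclosed Y le' U"
  then have "mass \<theta>1 (X \<inter> h -` U) \<le> mass \<theta>2 (X \<inter> h -` U)"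
    using assms(1,2) upclosed_vimage unfolding heavier_higher_def by blast
  then show "mass (OP_map h \<theta>1) U \<le> mass (OP_map h \<theta>2) U"
    using assms(3,4) by (simp add: mass_OP_map OP_finite_support mass_Int_carrier)
qed

text \<open>An equality is two inequalities, and each of them cancels.\<close>

lemma cancellative_add_left_imp_eq:
  assumes "cancellative TYPE('p::bot_ordered_semiring)" "r + s = r + (t :: 'p)"
  shows "s = t"
  using assms unfolding cancellative_def by (metis antisym order_refl)

section \<open>Antisymmetry and the collapse of the quotient\<close>

lemma heavier_higher_antisym:
  fixes \<theta>1 \<theta>2 :: "'a \<Rightarrow> 'p::bot_ordered_semiring"
  assumes canc: "cancellative TYPE('p)" and X: "poset_on X le"
    and \<theta>: "\<theta>1 \<in> OP X" "\<theta>2 \<in> OP X"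
    and hh: "heavier_higher X le \<theta>1 \<theta>2" "heavier_higher X le \<theta>2 \<theta>1"
  shows "\<theta>1 = \<theta>2"
proof
  fix x
  show "\<theta>1 x = \<theta>2 x"
  proof (cases "x \<in> X")
    case True
    let ?U = "{y \<in> X. le x y \<and> y \<noteq> x}"
    have le_trans: "le x z" if "y \<in> X" "z \<in> X" "le x y" "le y z" for y z
      using X True that unfolding poset_on_def transp_on_def by blast
    have le_antisym: "y = x" if "y \<in> X" "le x y" "le y x" for y
      using X True that unfolding poset_on_def antisymp_on_def by blast
    \<comment> \<open>Transitivity keeps a step upwards above \<open>x\<close>, and antisymmetry
      prevents it from leading out of \<open>?U\<close> back to \<open>x\<close>.\<close>
    have up: "upclosed X le ?U" "upclosed X le (insert x ?U)"
      using True le_trans le_antisym unfolding upclosed_def by blast+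
    have eq: "mass \<theta>1 V = mass \<theta>2 V" if "upclosed X le V" for V
      using hh that unfolding heavier_higher_def by (blast intro: antisym)
    have ins: "mass \<theta> (insert x ?U) = mass \<theta> ?U + \<theta> x" if "\<theta> \<in> OP X" for \<theta> :: "'a \<Rightarrow> 'p"
      using that by (intro mass_insert OP_finite_support) auto
    \<comment> \<open>The chain ends with the same left summand \<open>mass \<theta>1 ?U\<close> on
      both sides, which is what cancellation requires.\<close>
    have "mass \<theta>1 ?U + \<theta>1 x = mass \<theta>1 (insert x ?U)"
      by (rule ins[OF \<theta>(1), symmetric])
    also have "\<dots> = mass \<theta>2 (insert x ?U)"
      by (rule eq[OF up(2)])
    also have "\<dots> = mass \<theta>1 ?U + \<theta>2 x"
      unfolding eq[OF up(1)] by (rule ins[OF \<theta>(2)])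
    finally have "mass \<theta>1 ?U + \<theta>1 x = mass \<theta>1 ?U + \<theta>2 x" .
    then show ?thesis
      using cancellative_add_left_imp_eq[OF canc] by blast
  \<comment> \<open>Equality has to hold on the whole type; outside \<open>X\<close> both functions
    take the default value 0.\<close>
  qed (simp add: OP_outside[OF \<theta>(1)] OP_outside[OF \<theta>(2)])
qed

lemma hh_class_singleton:
  fixes \<theta> :: "'a \<Rightarrow> 'p::bot_ordered_semiring"
  assumes "cancellative TYPE('p)" "poset_on X le" "\<theta> \<in> OP X"
  shows "hh_class X le \<theta> = {\<theta>}"
  using assms heavier_higher_antisym[OF assms(1,2)] heavier_higher_refl
  unfolding hh_class_def hh_equiv_def by blast

text \<open>Writing the quotient as an image turns quantifiers over classes into quantifiers over
  functions in \<open>OP X\<close>.\<close>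

lemma OPbar_singletons:
  assumes "cancellative TYPE('p::bot_ordered_semiring)" "poset_on X le"
  shows "(OPbar X le :: ('a \<Rightarrow> 'p) set set) = (\<lambda>\<theta>. {\<theta>}) ` OP X"
  using hh_class_singleton[OF assms]
  unfolding OPbar_def quotient_def hh_class_def by auto

lemma OPbar_le_singletons: "OPbar_le X le {\<theta>1} {\<theta>2} \<longleftrightarrow> heavier_higher X le \<theta>1 \<theta>2"
  by (simp add: OPbar_le_def)

text \<open>With \<open>f\<close> the singleton map, every argument of \<open>rho_bar\<close>
  becomes the image of a term over \<open>OP X\<close>.\<close>

lemma sig_set_image: "sig_set (f ` A) = sig_map f ` sig_set A"
proof (intro subset_antisym subsetI)
  fix t assume "t \<in> sig_set (f ` A)"
  then consider "t = Inl ()" | r a where "t = Inr (Inl (r, f a))" "a \<in> A"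
    | a b where "t = Inr (Inr (f a, f b))" "a \<in> A" "b \<in> A"
    by (auto simp: sig_set_def)
  then show "t \<in> sig_map f ` sig_set A"
  proof cases
    case 1
    then show ?thesis by (intro image_eqI[of _ _ "Inl ()"]) (auto simp: sig_map_def sig_set_def)
  next
    case (2 r a)
    then show ?thesis
      by (intro image_eqI[of _ _ "Inr (Inl (r, a))"]) (auto simp: sig_map_def sig_set_def)
  next
    case (3 a b)
    then show ?thesis
      by (intro image_eqI[of _ _ "Inr (Inr (a, b))"]) (auto simp: sig_map_def sig_set_def)
  qed
qed (auto simp: sig_map_def sig_set_def)

text \<open>Both sides compare the terms summand by summand. With \<open>f\<close> the singleton map
  this reduces monotonicity of \<open>rho_bar\<close> to that of \<open>rho\<close>.\<close>

lemma sig_le_sig_map: "sig_le R (sig_map f s) (sig_map f t) \<longleftrightarrow> sig_le (\<lambda>x y. R (f x) (f y)) s t"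
  unfolding sig_le_def sig_map_def
  by (cases s rule: sum.exhaust; cases t rule: sum.exhaust)
    (auto simp: rel_sum_simps map_sum_def rel_prod_sel split: sum.splits)

text \<open>The unions over representatives range over one-element sets, and the result of each
  operation stays in \<open>OP X\<close>, where classes are singletons.\<close>

lemma rho_bar_sig_map_singleton:
  fixes t :: "('p::bot_ordered_semiring, 'a \<Rightarrow> 'p) sig"
  assumes "cancellative TYPE('p)" "poset_on X le" "t \<in> sig_set (OP X)"
  shows "rho_bar X le (sig_map (\<lambda>\<theta>. {\<theta>}) t) = {rho t}"
  using assms(3)
  by (auto simp: sig_set_def sig_map_def zeroF_OP scaleF_OP addF_OP
      hh_class_singleton[OF assms(1,2)])

theorem theorem14:
  fixes X :: "'a set" and le :: "'a \<Rightarrow> 'a \<Rightarrow> bool"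
  assumes "cancellative TYPE('p::bot_ordered_semiring)"
    and "poset_on X le"
  shows
    "antisymp_on (OP X :: ('a \<Rightarrow> 'p) set) (heavier_higher X le)
     \<and> poset_on (OPbar X le :: ('a \<Rightarrow> 'p) set set) (OPbar_le X le)
     \<and> bij_betw (hh_class X le) (OP X :: ('a \<Rightarrow> 'p) set) (OPbar X le)
     \<and> (\<forall>(Y :: 'b set) le' h. poset_on Y le' \<and> pos_hom X le Y le' h \<longrightarrow>
          pos_hom (OPbar X le :: ('a \<Rightarrow> 'p) set set) (OPbar_le X le)
            (OPbar Y le') (OPbar_le Y le') (OPbar_map Y le' h)
          \<and> (\<forall>\<theta> \<in> (OP X :: ('a \<Rightarrow> 'p) set).
               OPbar_map Y le' h (hh_class X le \<theta>) = hh_class Y le' (OP_map h \<theta>)))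
     \<and> pos_hom X le (OPbar X le :: ('a \<Rightarrow> 'p) set set) (OPbar_le X le) (delta_bar X le)
     \<and> (\<forall>x\<in>X. delta_bar X le x = hh_class X le (delta x :: 'a \<Rightarrow> 'p))
     \<and> pos_hom (sig_set (OPbar X le :: ('a \<Rightarrow> 'p) set set)) (sig_le (OPbar_le X le))
         (OPbar X le) (OPbar_le X le) (rho_bar X le)
     \<and> (\<forall>t \<in> sig_set (OP X :: ('a \<Rightarrow> 'p) set).
          rho_bar X le (sig_map (hh_class X le) t) = hh_class X le (rho t))"
proof -
  note canc = assms(1)
  note cls = hh_class_singleton[OF assms]
  note bar = OPbar_singletons[OF assms]
  have anti: "antisymp_on (OP X :: ('a \<Rightarrow> 'p) set) (heavier_higher X le)"
    using heavier_higher_antisym[OF assms] by (auto intro: antisymp_onI)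
  have poset: "poset_on (OPbar X le :: ('a \<Rightarrow> 'p) set set) (OPbar_le X le)"
    unfolding bar poset_on_def
    using heavier_higher_antisym[OF assms]
    by (auto intro!: reflp_onI antisymp_onI transp_onI simp: OPbar_le_singletons
        heavier_higher_refl intro: heavier_higher_trans)
  have bij: "bij_betw (hh_class X le) (OP X :: ('a \<Rightarrow> 'p) set) (OPbar X le)"
    unfolding bar bij_betw_def by (auto simp: inj_on_def cls)
  have map: "pos_hom (OPbar X le :: ('a \<Rightarrow> 'p) set set) (OPbar_le X le)
            (OPbar Y le') (OPbar_le Y le') (OPbar_map Y le' h)
          \<and> (\<forall>\<theta> \<in> (OP X :: ('a \<Rightarrow> 'p) set).
               OPbar_map Y le' h (hh_class X le \<theta>) = hh_class Y le' (OP_map h \<theta>))"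
    \<comment> \<open>Classes over \<open>Y\<close> are singletons too, since cancellativity
      concerns only the semiring.\<close>
    if "poset_on Y le'" and h: "pos_hom X le Y le' h" for Y :: "'b set" and le' h
  proof -
    have im: "OP_map h \<theta> \<in> OP Y" if "\<theta> \<in> OP X" for \<theta> :: "'a \<Rightarrow> 'p"
      using h that by (auto simp: pos_hom_def intro: OP_map_OP)
    have "OPbar_map Y le' h {\<theta>} = {OP_map h \<theta>}" if "\<theta> \<in> OP X" for \<theta> :: "'a \<Rightarrow> 'p"
      using hh_class_singleton[OF canc \<open>poset_on Y le'\<close> im[OF that]] by (simp add: OPbar_map_def)
    then show ?thesis
      unfolding pos_hom_def monotone_on_def bar OPbar_singletons[OF canc \<open>poset_on Y le'\<close>]
      by (auto simp: im cls hh_class_singleton[OF canc \<open>poset_on Y le'\<close>] OPbar_le_singletons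
          intro: heavier_higher_OP_map[OF h])
  qed
  have delta: "pos_hom X le (OPbar X le :: ('a \<Rightarrow> 'p) set set) (OPbar_le X le) (delta_bar X le)"
    unfolding pos_hom_def monotone_on_def bar
    by (auto simp: delta_bar_def cls delta_OP OPbar_le_singletons intro: heavier_higher_delta)
  have rho: "pos_hom (sig_set (OPbar X le :: ('a \<Rightarrow> 'p) set set)) (sig_le (OPbar_le X le))
         (OPbar X le) (OPbar_le X le) (rho_bar X le)"
    unfolding pos_hom_def monotone_on_def bar sig_set_image
    by (auto simp: rho_bar_sig_map_singleton[OF assms] rho_OP OPbar_le_singletons sig_le_sig_map
        intro: heavier_higher_rho)
  \<comment> \<open>The two maps are known to agree only on \<open>OP X\<close>, so the rewriting is
    restricted to terms over \<open>OP X\<close>.\<close>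
  have "sig_map (hh_class X le) t = sig_map (\<lambda>\<theta>. {\<theta>}) t"
    if "t \<in> sig_set (OP X)" for t :: "('p, 'a \<Rightarrow> 'p) sig"
    using that by (auto simp: sig_set_def sig_map_def cls)
  then have "\<forall>t \<in> sig_set (OP X :: ('a \<Rightarrow> 'p) set).
          rho_bar X le (sig_map (hh_class X le) t) = hh_class X le (rho t)"
    by (simp add: rho_bar_sig_map_singleton[OF assms] cls rho_OP)
  with anti poset bij map delta rho show ?thesis
    by (simp add: delta_bar_def)
qed

end
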